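(* Let the quantum program $P=P(C_1,\dots,C_n)$ contain quantum circuits $C_1,\dots,C_n$, and let $Q=P(D_1,\dots,D_n)$ be the quantum program obtained through substituting $C_1,\dots,C_n$ in $P$ by quantum circuits $D_1,\dots,D_n$, respectively. If $C_i\equiv D_i$ (as circuits) for $i=1,\dots,n$, then $P\equiv Q$ (as programs).
   Context: A set $QV$ of quantum variables is given; each quantum variable $q$ has a Hilbert space $\mathcal H_q$; a register $\bar q$ is a sequence $q_1,\dots,q_n$ of distinct variables (identified with its set) with space $\mathcal H_{\bar q}=\bigotimes_i\mathcal H_{q_i}$. $\mathcal H_{QV}$ is the state space of the composite system of all variables in $QV$; operators on registers are identified with their extensions by the identity where needed. $\mathcal D(\mathcal H_{QV})$ is the set of partial density operators (positive operators of trace $\le1$) on $\mathcal H_{QV}$. Circuits: $C::=\mathbf{skip}\mid U[\bar q]\mid C_1;C_2\mid \mathbf{qif}\,[\bar q](\square_{i=1}^d|\psi_i\rangle\to C_i)\,\mathbf{fiq}$ ($U$ a unitary constant from a given set, $\{|\psi_i\rangle\}$ an orthonormal basis of $\mathcal H_{\bar q}$, $\bar q$ disjoint from the variables of all $C_i$); $qv(C)$ is the set of variables occurring in $C$. $[\![C]\!]$ is a unitary on $\mathcal H_{qv(C)}$: respectively $I$, $U_{\bar q}$, $[\![C_2]\!][\![C_1]\!]$, $\sum_i|\psi_i\rangle_{\bar q}\langle\psi_i|\otimes[\![C_i]\!]$ (operators extended by the identity to all variables of the circuit). Circuit equivalence: $C\equiv D$ iff $[\![C]\!]\otimes I_{qv(D)\setminus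 qv(C)}=[\![D]\!]\otimes I_{qv(C)\setminus qv(D)}$. A measurement on $\bar q$ is a family $M=\{M_m\}$ of linear operators with $\sum_mM_m^\dagger M_m=I$. Programs: $P::=\mathbf{skip}\mid\mathbf{abort}\mid\bar q:=|\psi\rangle\mid C\mid P_1;P_2\mid\mathbf{if}\,M[\bar q](\square m\to P_m)\,\mathbf{fi}\mid\mathbf{while}\,M[\bar q]=1\,\mathbf{do}\,P\,\mathbf{od}$ (in loops $M$ has outcomes $0,1$), where $C$ is any circuit. Semantics on $\mathcal D(\mathcal H_{QV})$: $[\![\mathbf{skip}]\!](\rho)=\rho$; $[\![\mathbf{abort}]\!](\rho)=0$; $[\![\bar q:=|\psi\rangle]\!](\rho)=\sum_n|\psi\rangle_{\bar q}\langle n|\rho|n\rangle_{\bar q}\langle\psi|$ ($\{|n\rangle\}$ an orthonormal basis of $\mathcal H_{\bar q}$); $[\![C]\!](\rho)=[\![C]\!]\rho[\![C]\!]^\dagger$; $[\![P_1;P_2]\!]=[\![P_2]\!]\circ[\![P_1]\!]$; $[\![\mathbf{if}\,M[\bar q](\square m\to P_m)\,\mathbf{fi}]\!](\rho)=\sum_m[\![P_m]\!](M_m\rho M_m^\dagger)$; $[\![\mathbf{while}\,M[\bar q]=1\,\mathbf{do}\,P\,\mathbf{od}]\!]=\sum_{n\ge0}\mathcal E_0\circ([\![P]\!]\circ\mathcal E_1)^n$, $\mathcal E_i(\rho)=M_i\rho M_i^\dagger$. Program equivalence: $P\equiv Q$ iff $[\![P]\!](\rho)=[\![Q]\!](\rho)$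 for all $\rho\in\mathcal D(\mathcal H_{QV})$. *)

theory Defs
  imports "HOL-Analysis.Analysis"
begin

section \<open>Hilbert spaces and operators\<close>

text \<open>
  Every Hilbert space is, up to an isometry, the space of square-summable functions on an
  orthonormal basis. A space is therefore given by its set \<open>X\<close> of basis labels, and may have any
  dimension. Vectors vanish outside \<open>X\<close>, so that equality of vectors is equality of functions.
  An operator is a function on vectors; only its values on \<^term>\<open>ell2 X\<close> are meaningful.
\<close>

type_synonym 'x amp = "'x \<Rightarrow> complex"
type_synonym 'x op = "'x amp \<Rightarrow> 'x amp"

definition ell2 :: "'x set \<Rightarrow> 'x amp set" where
  "ell2 X = {f. (\<forall>x. x \<notin> X \<longrightarrow> f x = 0) \<and> (\<lambda>x. (cmod (f x))\<^sup>2) summable_on X}"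

definition cinner :: "'x set \<Rightarrow> 'x amp \<Rightarrow> 'x amp \<Rightarrow> complex" where
  "cinner X f g = (\<Sum>\<^sub>\<infinity>x\<in>X. cnj (f x) * g x)"

definition cnorm :: "'x set \<Rightarrow> 'x amp \<Rightarrow> real" where
  "cnorm X f = sqrt (\<Sum>\<^sub>\<infinity>x\<in>X. (cmod (f x))\<^sup>2)"

definition ket :: "'x \<Rightarrow> 'x amp" where
  "ket x = (\<lambda>y. if y = x then 1 else 0)"

definition dyad :: "'x set \<Rightarrow> 'x amp \<Rightarrow> 'x amp \<Rightarrow> 'x op" where
  "dyad X f g = (\<lambda>\<phi> x. f x * cinner X g \<phi>)"

definition bounded_op :: "'x set \<Rightarrow> 'x op \<Rightarrow> bool" where
  "bounded_op X A \<longleftrightarrow>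
     (\<forall>f\<in>ell2 X. A f \<in> ell2 X) \<and>
     (\<forall>f\<in>ell2 X. \<forall>g\<in>ell2 X. A (\<lambda>x. f x + g x) = (\<lambda>x. A f x + A g x)) \<and>
     (\<forall>c. \<forall>f\<in>ell2 X. A (\<lambda>x. c * f x) = (\<lambda>x. c * A f x)) \<and>
     (\<exists>K. \<forall>f\<in>ell2 X. cnorm X (A f) \<le> K * cnorm X f)"

definition op_eq :: "'x set \<Rightarrow> 'x op \<Rightarrow> 'x op \<Rightarrow> bool" where
  "op_eq X A A' \<longleftrightarrow> (\<forall>f\<in>ell2 X. A f = A' f)"

text \<open>The coordinate of the adjoint applied to \<open>f\<close> at a basis label \<open>x\<close> is the inner product of
  \<open>ket x\<close> with it, hence that of \<open>A (ket x)\<close> with \<open>f\<close>.\<close>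

definition adj :: "'x set \<Rightarrow> 'x op \<Rightarrow> 'x op" where
  "adj X A = (\<lambda>f x. if x \<in> X then cinner X (A (ket x)) f else 0)"

definition unitary :: "'x set \<Rightarrow> 'x op \<Rightarrow> bool" where
  "unitary X U \<longleftrightarrow> bounded_op X U \<and> op_eq X (adj X U \<circ> U) id \<and> op_eq X (U \<circ> adj X U) id"

definition orthonormal_basis :: "'x set \<Rightarrow> nat \<Rightarrow> (nat \<Rightarrow> 'x amp) \<Rightarrow> bool" where
  "orthonormal_basis X d \<psi> \<longleftrightarrow>
     (\<forall>i\<in>{1..d}. \<psi> i \<in> ell2 X) \<and>
     (\<forall>i\<in>{1..d}. \<forall>j\<in>{1..d}. cinner X (\<psi> i) (\<psi> j) = (if i = j then 1 else 0)) \<and>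
     (\<forall>f\<in>ell2 X. \<exists>c. f = (\<lambda>x. \<Sum>i=1..d. c i * \<psi> i x))"

text \<open>Infinite sums of operators are taken in every coordinate of every value. For the series below
  (sums of positive operators with bounded traces, and \<open>\<Sum>\<^sub>m M\<^sub>m\<^sup>\<dagger> M\<^sub>m = I\<close>) this limit is also the
  limit in the strong operator topology.\<close>

definition op_sum :: "'i set \<Rightarrow> ('i \<Rightarrow> 'x op) \<Rightarrow> 'x op" where
  "op_sum I F = (\<lambda>f x. \<Sum>\<^sub>\<infinity>i\<in>I. F i f x)"

definition measurement :: "'x set \<Rightarrow> 'm set \<Rightarrow> ('m \<Rightarrow> 'x op) \<Rightarrow> bool" where
  "measurement X Out M \<longleftrightarrow>
     (\<forall>m\<in>Out. bounded_op X (M m)) \<and>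
     (\<forall>f\<in>ell2 X. \<forall>x\<in>X. ((\<lambda>m. adj X (M m) (M m f) x) has_sum f x) Out)"

definition partial_density :: "'x set \<Rightarrow> 'x op \<Rightarrow> bool" where
  "partial_density X \<rho> \<longleftrightarrow>
     bounded_op X \<rho> \<and>
     (\<forall>f\<in>ell2 X. cinner X f (\<rho> f) \<in> \<real>\<^sub>\<ge>\<^sub>0) \<and>
     (\<lambda>x. Re (cinner X (ket x) (\<rho> (ket x)))) summable_on X \<and>
     (\<Sum>\<^sub>\<infinity>x\<in>X. Re (cinner X (ket x) (\<rho> (ket x)))) \<le> 1"

definition sandwich :: "'x set \<Rightarrow> 'x op \<Rightarrow> 'x op \<Rightarrow> 'x op" where
  "sandwich X A \<rho> = A \<circ> \<rho> \<circ> adj X A"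

section \<open>Syntax\<close>

text \<open>The quantum variables are the elements of the type \<open>'q\<close>; basis labels have type \<open>'b\<close>.
  Gates, measurement operators and vectors for a register \<open>[q\<^sub>1, \<dots>, q\<^sub>n]\<close> refer to its variables by
  position: they act on functions of the label list \<open>[b\<^sub>1, \<dots>, b\<^sub>n]\<close>.
  In \<open>QIf q d \<psi> C\<close> only the branches \<open>1, \<dots>, d\<close> matter, and in \<open>If Out M q P\<close> only the outcomes in
  \<open>Out\<close>. Skip and sequencing are available both for circuits and for programs.\<close>

datatype ('q, 'b) circuit =
    CSkip
  | Gate "'b list op" "'q list"
  | CSeq "('q, 'b) circuit" "('q, 'b) circuit"
  | QIf "'q list" nat "nat \<Rightarrow> 'b list amp" "nat \<Rightarrow> ('q, 'b) circuit"

datatype ('q, 'b, 'm) prog =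
    Skip
  | Abort
  | Init "'q list" "'b list amp"
  | Circ "('q, 'b) circuit"
  | Seq "('q, 'b, 'm) prog" "('q, 'b, 'm) prog"
  | If "'m set" "'m \<Rightarrow> 'b list op" "'q list" "'m \<Rightarrow> ('q, 'b, 'm) prog"
  | While "nat \<Rightarrow> 'b list op" "'q list" "('q, 'b, 'm) prog"

primrec qv :: "('q, 'b) circuit \<Rightarrow> 'q set" where
  "qv CSkip = {}"
| "qv (Gate U q) = set q"
| "qv (CSeq C\<^sub>1 C\<^sub>2) = qv C\<^sub>1 \<union> qv C\<^sub>2"
| "qv (QIf q d \<psi> C) = set q \<union> (\<Union>i\<in>{1..d}. qv (C i))"

text \<open>\<open>csubst R C D\<close> and \<open>psubst R P Q\<close>: the second argument becomes the third when circuits occurring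
  in it, possibly inside larger circuits, are replaced by their partners in \<open>R\<close>.\<close>

inductive csubst :: "(('q, 'b) circuit \<times> ('q, 'b) circuit) set
    \<Rightarrow> ('q, 'b) circuit \<Rightarrow> ('q, 'b) circuit \<Rightarrow> bool" for R where
  replace: "(C, D) \<in> R \<Longrightarrow> csubst R C D"
| keep: "csubst R C C"
| seq: "csubst R C\<^sub>1 D\<^sub>1 \<Longrightarrow> csubst R C\<^sub>2 D\<^sub>2 \<Longrightarrow> csubst R (CSeq C\<^sub>1 C\<^sub>2) (CSeq D\<^sub>1 D\<^sub>2)"
| qif: "(\<forall>i\<in>{1..d}. csubst R (C i) (D i)) \<Longrightarrow> csubst R (QIf q d \<psi> C) (QIf q d \<psi> D)"

inductive psubst :: "(('q, 'b) circuit \<times> ('q, 'b) circuit) set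
    \<Rightarrow> ('q, 'b, 'm) prog \<Rightarrow> ('q, 'b, 'm) prog \<Rightarrow> bool" for R where
  circ: "csubst R C D \<Longrightarrow> psubst R (Circ C) (Circ D)"
| keep: "psubst R P P"
| seq: "psubst R P\<^sub>1 Q\<^sub>1 \<Longrightarrow> psubst R P\<^sub>2 Q\<^sub>2 \<Longrightarrow> psubst R (Seq P\<^sub>1 P\<^sub>2) (Seq Q\<^sub>1 Q\<^sub>2)"
| cond: "(\<forall>m\<in>Out. psubst R (P m) (Q m)) \<Longrightarrow> psubst R (If Out M q P) (If Out M q Q)"
| loop: "psubst R P Q \<Longrightarrow> psubst R (While M q P) (While M q Q)"

section \<open>Semantics\<close>

text \<open>\<open>B q\<close> is the set of basis labels of the space of \<open>q\<close>. For finite \<open>V\<close>, the labels of the tensor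
  product over \<open>V\<close> are all of \<open>PiE V B\<close> and \<open>r\<close> plays no role. For infinite \<open>V\<close>, which occurs only if
  there are infinitely many quantum variables, the tensor product is von Neumann's incomplete tensor
  product determined by the reference vectors \<open>ket (r q)\<close>; its labels differ from \<open>r\<close> in finitely many
  variables.\<close>

context
  fixes B :: "'q \<Rightarrow> 'b set" and r :: "'q \<Rightarrow> 'b"
begin

definition labels :: "'q set \<Rightarrow> ('q \<Rightarrow> 'b) set" where
  "labels V = {s \<in> PiE V B. finite {q \<in> V. s q \<noteq> r q}}"

definition reg_labels :: "'q list \<Rightarrow> 'b list set" where
  "reg_labels q = listset (map B q)"

definition place :: "'q list \<Rightarrow> 'b list op \<Rightarrow> ('q \<Rightarrow> 'b) op" where
  "place q A = (\<lambda>f s. if s \<in> labels (set q)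
     then A (\<lambda>bs. if bs \<in> reg_labels q
                  then f (\<lambda>v\<in>set q. the (map_of (zip q bs) v)) else 0)
            (map s q)
     else 0)"

text \<open>For an operator \<open>A\<close> on the space of \<open>W \<subseteq> V\<close>, \<open>ext V W A\<close> is \<open>A\<close> tensored with the identity on
  \<open>V - W\<close>: \<open>A\<close> acts on the slices obtained by fixing the labels outside \<open>W\<close>.
  The operator is given the value 0 on arguments that are not vectors of the space.\<close>

definition ext :: "'q set \<Rightarrow> 'q set \<Rightarrow> ('q \<Rightarrow> 'b) op \<Rightarrow> ('q \<Rightarrow> 'b) op" where
  "ext V W A = (\<lambda>f s. if f \<in> ell2 (labels V) \<and> s \<in> labels V
     then A (\<lambda>t. if t \<in> labels W then f (override_on s t W) else 0) (restrict s W)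
     else 0)"

abbreviation reg_ext :: "'q set \<Rightarrow> 'q list \<Rightarrow> 'b list op \<Rightarrow> ('q \<Rightarrow> 'b) op" where
  "reg_ext V q A \<equiv> ext V (set q) (place q A)"

primrec wf_circuit :: "'b list op set \<Rightarrow> ('q, 'b) circuit \<Rightarrow> bool" where
  "wf_circuit G CSkip \<longleftrightarrow> True"
| "wf_circuit G (Gate U q) \<longleftrightarrow> distinct q \<and> U \<in> G \<and> unitary (reg_labels q) U"
| "wf_circuit G (CSeq C\<^sub>1 C\<^sub>2) \<longleftrightarrow> wf_circuit G C\<^sub>1 \<and> wf_circuit G C\<^sub>2"
| "wf_circuit G (QIf q d \<psi> C) \<longleftrightarrow>
     distinct q \<and> orthonormal_basis (reg_labels q) d \<psi> \<and>
     (\<forall>i\<in>{1..d}. wf_circuit G (C i) \<and> set q \<inter> qv (C i) = {})"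

primrec csem :: "('q, 'b) circuit \<Rightarrow> ('q \<Rightarrow> 'b) op" where
  "csem CSkip = id"
| "csem (Gate U q) = place q U"
| "csem (CSeq C\<^sub>1 C\<^sub>2) =
     ext (qv C\<^sub>1 \<union> qv C\<^sub>2) (qv C\<^sub>2) (csem C\<^sub>2) \<circ> ext (qv C\<^sub>1 \<union> qv C\<^sub>2) (qv C\<^sub>1) (csem C\<^sub>1)"
| "csem (QIf q d \<psi> C) =
     (let V = set q \<union> (\<Union>i\<in>{1..d}. qv (C i)) in
      (\<lambda>f s. \<Sum>i=1..d. (reg_ext V q (dyad (reg_labels q) (\<psi> i) (\<psi> i))
        \<circ> ext V (qv (C i)) (csem (C i))) f s))"

definition circ_equiv :: "('q, 'b) circuit \<Rightarrow> ('q, 'b) circuit \<Rightarrow> bool" where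
  "circ_equiv C D \<longleftrightarrow>
     op_eq (labels (qv C \<union> qv D))
       (ext (qv C \<union> qv D) (qv C) (csem C)) (ext (qv C \<union> qv D) (qv D) (csem D))"

primrec wf_prog :: "'b list op set \<Rightarrow> ('q, 'b, 'm) prog \<Rightarrow> bool" where
  "wf_prog G Skip \<longleftrightarrow> True"
| "wf_prog G Abort \<longleftrightarrow> True"
| "wf_prog G (Init q \<psi>) \<longleftrightarrow>
     distinct q \<and> \<psi> \<in> ell2 (reg_labels q) \<and> cnorm (reg_labels q) \<psi> = 1"
| "wf_prog G (Circ C) \<longleftrightarrow> wf_circuit G C"
| "wf_prog G (Seq P\<^sub>1 P\<^sub>2) \<longleftrightarrow> wf_prog G P\<^sub>1 \<and> wf_prog G P\<^sub>2"
| "wf_prog G (If Out M q P) \<longleftrightarrow>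
     distinct q \<and> measurement (reg_labels q) Out M \<and> (\<forall>m\<in>Out. wf_prog G (P m))"
| "wf_prog G (While M q P) \<longleftrightarrow>
     distinct q \<and> measurement (reg_labels q) {0, 1} M \<and> wf_prog G P"

text \<open>\<open>conj_at q A \<rho>\<close> is \<open>A \<rho> A\<^sup>\<dagger>\<close> on the space of all quantum variables, where \<open>A\<close> acts on the
  register \<open>q\<close>.\<close>

definition conj_at :: "'q list \<Rightarrow> 'b list op \<Rightarrow> ('q \<Rightarrow> 'b) op \<Rightarrow> ('q \<Rightarrow> 'b) op" where
  "conj_at q A = sandwich (labels UNIV) (reg_ext UNIV q A)"

primrec psem :: "('q, 'b, 'm) prog \<Rightarrow> ('q \<Rightarrow> 'b) op \<Rightarrow> ('q \<Rightarrow> 'b) op" where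
  "psem Skip = id"
| "psem Abort = (\<lambda>\<rho> f s. 0)"
| "psem (Init q \<psi>) =
     (\<lambda>\<rho>. op_sum (reg_labels q) (\<lambda>bs. conj_at q (dyad (reg_labels q) \<psi> (ket bs)) \<rho>))"
| "psem (Circ C) = sandwich (labels UNIV) (ext UNIV (qv C) (csem C))"
| "psem (Seq P\<^sub>1 P\<^sub>2) = psem P\<^sub>2 \<circ> psem P\<^sub>1"
| "psem (If Out M q P) = (\<lambda>\<rho>. op_sum Out (\<lambda>m. psem (P m) (conj_at q (M m) \<rho>)))"
| "psem (While M q P) =
     (\<lambda>\<rho>. op_sum UNIV (\<lambda>n. conj_at q (M 0) (((psem P \<circ> conj_at q (M 1)) ^^ n) \<rho>)))"

definition prog_equiv :: "('q, 'b, 'm) prog \<Rightarrow> ('q, 'b, 'm) prog \<Rightarrow> bool" where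
  "prog_equiv P Q \<longleftrightarrow>
     (\<forall>\<rho>. partial_density (labels UNIV) \<rho> \<longrightarrow> op_eq (labels UNIV) (psem P \<rho>) (psem Q \<rho>))"

end

end

theory Submission
  imports Defs
begin

text \<open>
  Extension by the identity is transitive, and it is multiplicative on bounded operators. So the
  extension of a composite circuit to all variables is determined by those of its parts, although
  equivalent parts may have different sets of variables. Boundedness is what makes this work: an
  extended operator is \<open>0\<close> outside \<^term>\<open>ell2\<close>, hence the intermediate vectors of a composition
  must be square-summable. By the same convention, extended operators that agree on \<^term>\<open>ell2\<close> are
  equal as functions, so the two program semantics are equal on all arguments.
\<close>

section \<open>Bounded maps on square-summable functions\<close>

abbreviation energy :: "'x set \<Rightarrow> 'x amp \<Rightarrow> real" where
  "energy X f \<equiv> (\<Sum>\<^sub>\<infinity>x\<in>X. (cmod (f x))\<^sup>2)"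

text \<open>The bound is on squared norms: these add up over slices, and the constant
  \<open>K\<close> passes through the sum.\<close>

definition ell2_bounded :: "'x set \<Rightarrow> 'x op \<Rightarrow> bool" where
  "ell2_bounded X A \<longleftrightarrow>
     (\<exists>K\<ge>0. \<forall>f\<in>ell2 X. A f \<in> ell2 X \<and> energy X (A f) \<le> K * energy X f)"

lemma ell2_boundedI:
  assumes "K \<ge> 0" "\<And>f. f \<in> ell2 X \<Longrightarrow> A f \<in> ell2 X"
    and "\<And>f. f \<in> ell2 X \<Longrightarrow> energy X (A f) \<le> K * energy X f"
  shows "ell2_bounded X A"
  using assms unfolding ell2_bounded_def by blast

lemma ell2_bounded_in: "ell2_bounded X A \<Longrightarrow> f \<in> ell2 X \<Longrightarrow> A f \<in> ell2 X"
  unfolding ell2_bounded_def by blast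

lemma energy_nonneg: "energy X f \<ge> 0"
  by (rule infsum_nonneg) simp

lemma ell2_summable: "f \<in> ell2 X \<Longrightarrow> (\<lambda>x. (cmod (f x))\<^sup>2) summable_on X"
  by (simp add: ell2_def)

lemma ell2_outside: "f \<in> ell2 X \<Longrightarrow> x \<notin> X \<Longrightarrow> f x = 0"
  by (simp add: ell2_def)

section \<open>Pulling vectors back along injections\<close>

lemma nonneg_reindex:
  fixes F :: "'y \<Rightarrow> real"
  assumes "inj_on h X" "h ` X \<subseteq> Y" "F summable_on Y" "\<And>y. y \<in> Y \<Longrightarrow> F y \<ge> 0"
  shows "(\<lambda>x. F (h x)) summable_on X" "(\<Sum>\<^sub>\<infinity>x\<in>X. F (h x)) \<le> infsum F Y"
proof -
  have s: "F summable_on (h ` X)"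
    using summable_on_subset_banach[OF assms(3,2)] .
  show "(\<lambda>x. F (h x)) summable_on X"
    using summable_on_reindex[OF assms(1), of F] s by (simp add: o_def)
  have "(\<Sum>\<^sub>\<infinity>x\<in>X. F (h x)) = infsum F (h ` X)"
    using infsum_reindex[OF assms(1), of F] by (simp add: o_def)
  also have "\<dots> \<le> infsum F Y"
    by (rule infsum_mono2[OF s assms(3,2)]) (use assms(4) in auto)
  finally show "(\<Sum>\<^sub>\<infinity>x\<in>X. F (h x)) \<le> infsum F Y" .
qed

text \<open>Slices and the label translations in \<open>place\<close> are pullbacks of this kind. As
  \<open>h\<close> is injective, each square of \<open>f\<close> is counted at most once.\<close>

lemma ell2_reindex:
  assumes "inj_on h X" "h ` X \<subseteq> Y" "f \<in> ell2 Y"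
  shows "(\<lambda>x. if x \<in> X then f (h x) else 0) \<in> ell2 X"
    and "energy X (\<lambda>x. if x \<in> X then f (h x) else 0) \<le> energy Y f"
proof -
  note r = nonneg_reindex[OF assms(1,2) ell2_summable[OF assms(3)]]
  have "(\<lambda>x. (cmod (if x \<in> X then f (h x) else 0))\<^sup>2) summable_on X
      \<longleftrightarrow> (\<lambda>x. (cmod (f (h x)))\<^sup>2) summable_on X"
    by (rule summable_on_cong) simp
  then show "(\<lambda>x. if x \<in> X then f (h x) else 0) \<in> ell2 X"
    using r(1) by (simp add: ell2_def)
  have "energy X (\<lambda>x. if x \<in> X then f (h x) else 0) = (\<Sum>\<^sub>\<infinity>x\<in>X. (cmod (f (h x)))\<^sup>2)"
    by (rule infsum_cong) simp
  then show "energy X (\<lambda>x. if x \<in> X then f (h x) else 0) \<le> energy Y f"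
    using r(2) by simp
qed

section \<open>Closure properties of bounded maps\<close>

lemma bounded_op_ell2_bounded:
  assumes "bounded_op X A"
  shows "ell2_bounded X A"
proof -
  obtain K where K: "\<And>f. f \<in> ell2 X \<Longrightarrow> cnorm X (A f) \<le> K * cnorm X f"
    and cl: "\<And>f. f \<in> ell2 X \<Longrightarrow> A f \<in> ell2 X"
    using assms unfolding bounded_op_def by blast
  show ?thesis
  proof (rule ell2_boundedI)
    \<comment> \<open>The \<open>K\<close> of \<open>bounded_op\<close> may have any sign; its
      square is a nonnegative constant.\<close>
    show "energy X (A f) \<le> K\<^sup>2 * energy X f" if f: "f \<in> ell2 X" for f
    proof -
      have "(cnorm X (A f))\<^sup>2 \<le> (K * cnorm X f)\<^sup>2"
        by (rule power_mono[OF K[OF f]]) (simp add: cnorm_def energy_nonneg)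
      then show ?thesis
        by (simp add: cnorm_def power_mult_distrib energy_nonneg)
    qed
  qed (use cl in auto)
qed

lemma ell2_bounded_id: "ell2_bounded X id"
  by (rule ell2_boundedI[of 1]) auto

lemma ell2_bounded_comp:
  assumes "ell2_bounded X A" "ell2_bounded X B"
  shows "ell2_bounded X (A \<circ> B)"
proof -
  obtain K where K: "K \<ge> 0" "\<And>f. f \<in> ell2 X \<Longrightarrow> A f \<in> ell2 X \<and> energy X (A f) \<le> K * energy X f"
    using assms(1) unfolding ell2_bounded_def by blast
  obtain L where L: "L \<ge> 0" "\<And>f. f \<in> ell2 X \<Longrightarrow> B f \<in> ell2 X \<and> energy X (B f) \<le> L * energy X f"
    using assms(2) unfolding ell2_bounded_def by blast
  show ?thesis
  proof (rule ell2_boundedI)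
    show "energy X ((A \<circ> B) f) \<le> (K * L) * energy X f" if f: "f \<in> ell2 X" for f
    proof -
      have "energy X (A (B f)) \<le> K * energy X (B f)"
        using K L f by blast
      also have "\<dots> \<le> K * (L * energy X f)"
        using K L f by (intro mult_left_mono) auto
      finally show ?thesis by simp
    qed
  qed (use K L in auto)
qed

text \<open>A crude substitute for the triangle inequality in \<open>ell2\<close>: the factor 2 is
  harmless, as only the existence of a bound matters.\<close>

lemma cmod_add_sq: "(cmod (a + b))\<^sup>2 \<le> 2 * (cmod a)\<^sup>2 + 2 * (cmod b)\<^sup>2"
proof -
  have "(cmod (a + b))\<^sup>2 \<le> (cmod a + cmod b)\<^sup>2"
    by (rule power_mono[OF norm_triangle_ineq]) simp
  also have "\<dots> \<le> 2 * (cmod a)\<^sup>2 + 2 * (cmod b)\<^sup>2"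
    using zero_le_power2[of "cmod a - cmod b"] by (simp add: power2_eq_square algebra_simps)
  finally show ?thesis .
qed

lemma ell2_bounded_add:
  assumes "ell2_bounded X A" "ell2_bounded X B"
  shows "ell2_bounded X (\<lambda>f x. A f x + B f x)"
proof -
  obtain K where K: "K \<ge> 0" "\<And>f. f \<in> ell2 X \<Longrightarrow> A f \<in> ell2 X \<and> energy X (A f) \<le> K * energy X f"
    using assms(1) unfolding ell2_bounded_def by blast
  obtain L where L: "L \<ge> 0" "\<And>f. f \<in> ell2 X \<Longrightarrow> B f \<in> ell2 X \<and> energy X (B f) \<le> L * energy X f"
    using assms(2) unfolding ell2_bounded_def by blast
  have *: "(\<lambda>x. A f x + B f x) \<in> ell2 X \<and>
      energy X (\<lambda>x. A f x + B f x) \<le> (2 * K + 2 * L) * energy X f" if f: "f \<in> ell2 X" for f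
  proof -
    have sA: "(\<lambda>x. 2 * (cmod (A f x))\<^sup>2) summable_on X"
      and sB: "(\<lambda>x. 2 * (cmod (B f x))\<^sup>2) summable_on X"
      using K(2)[OF f] L(2)[OF f] by (auto intro!: summable_on_cmult_right ell2_summable)
    note s = summable_on_add[OF sA sB]
    have s': "(\<lambda>x. (cmod (A f x + B f x))\<^sup>2) summable_on X"
      by (rule summable_on_comparison_test[OF s]) (auto simp: cmod_add_sq)
    have "energy X (\<lambda>x. A f x + B f x) \<le>
        (\<Sum>\<^sub>\<infinity>x\<in>X. 2 * (cmod (A f x))\<^sup>2 + 2 * (cmod (B f x))\<^sup>2)"
      by (rule infsum_mono[OF s' s]) (rule cmod_add_sq)
    also have "\<dots> = 2 * energy X (A f) + 2 * energy X (B f)"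
      by (simp add: infsum_add[OF sA sB] infsum_cmult_right')
    also have "\<dots> \<le> (2 * K + 2 * L) * energy X f"
      using K(2)[OF f] L(2)[OF f] by (simp add: algebra_simps)
    finally show ?thesis
      using s' K(2)[OF f] L(2)[OF f] by (auto simp: ell2_def)
  qed
  show ?thesis
    by (rule ell2_boundedI[of "2 * K + 2 * L"]) (use * K L in auto)
qed

lemma ell2_bounded_sum:
  assumes "finite I" "\<And>i. i \<in> I \<Longrightarrow> ell2_bounded X (F i)"
  shows "ell2_bounded X (\<lambda>f x. \<Sum>i\<in>I. F i f x)"
  using assms
proof (induction I)
  case empty
  show ?case by (rule ell2_boundedI[of 0]) (auto simp: ell2_def)
next
  case (insert i I)
  then show ?case
    using ell2_bounded_add[of X "F i" "\<lambda>f x. \<Sum>i\<in>I. F i f x"] by simp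
qed

text \<open>Cauchy-Schwarz. The inequality for finite sums gives the same right-hand side for every
  finite subset of \<open>X\<close>, hence for the infinite sum.\<close>

lemma cmod_cinner_le:
  assumes "f \<in> ell2 X" "g \<in> ell2 X"
  shows "cmod (cinner X f g) \<le> sqrt (energy X f) * sqrt (energy X g)"
proof -
  let ?h = "\<lambda>x. cmod (f x) * cmod (g x)"
  have s: "?h summable_on X"
  proof (rule summable_on_comparison_test)
    show "(\<lambda>x. (cmod (f x))\<^sup>2 + (cmod (g x))\<^sup>2) summable_on X"
      using assms by (intro summable_on_add ell2_summable)
    \<comment> \<open>For nonnegative \<open>a\<close> and \<open>b\<close>:
      \<open>a * b \<le> 2 * a * b \<le> a^2 + b^2\<close>.\<close>
    show "?h x \<le> (cmod (f x))\<^sup>2 + (cmod (g x))\<^sup>2" for x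
      using sum_squares_bound[of "cmod (f x)" "cmod (g x)"]
        mult_nonneg_nonneg[OF norm_ge_zero[of "f x"] norm_ge_zero[of "g x"]] by linarith
  qed simp
  have L: "L2_set (\<lambda>x. cmod (u x)) F \<le> sqrt (energy X u)"
    if "u \<in> ell2 X" "finite F" "F \<subseteq> X" for u F
    unfolding L2_set_def real_sqrt_le_iff
    by (rule finite_sum_le_infsum[OF ell2_summable]) (use that in auto)
  have "infsum ?h X \<le> sqrt (energy X f) * sqrt (energy X g)"
  proof (rule infsum_le_finite_sums[OF s])
    fix F assume F: "finite F" "F \<subseteq> X"
    have "sum ?h F \<le> L2_set (\<lambda>x. cmod (f x)) F * L2_set (\<lambda>x. cmod (g x)) F"
      using L2_set_mult_ineq[of "\<lambda>x. cmod (f x)" "\<lambda>x. cmod (g x)" F] by simp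
    also have "\<dots> \<le> sqrt (energy X f) * sqrt (energy X g)"
      by (intro mult_mono L assms F) (auto simp: energy_nonneg)
    finally show "sum ?h F \<le> sqrt (energy X f) * sqrt (energy X g)" .
  qed
  moreover have "cmod (cinner X f g) \<le> infsum ?h X"
    unfolding cinner_def
    using norm_infsum_bound[of "\<lambda>x. cnj (f x) * g x" X] s by (simp add: norm_mult)
  ultimately show ?thesis by linarith
qed

text \<open>Cauchy-Schwarz makes the product of the two squared norms a bound. The projectors in the
  semantics of \<open>QIf\<close> have this form.\<close>

lemma ell2_bounded_dyad:
  assumes "\<phi> \<in> ell2 X" "\<psi> \<in> ell2 X"
  shows "ell2_bounded X (dyad X \<phi> \<psi>)"
proof (rule ell2_boundedI[of "energy X \<phi> * energy X \<psi>"])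
  fix f assume f: "f \<in> ell2 X"
  have eq: "(\<lambda>x. (cmod (dyad X \<phi> \<psi> f x))\<^sup>2) = (\<lambda>x. (cmod (cinner X \<psi> f))\<^sup>2 * (cmod (\<phi> x))\<^sup>2)"
    by (auto simp: dyad_def norm_mult power_mult_distrib)
  have "(\<lambda>x. (cmod (cinner X \<psi> f))\<^sup>2 * (cmod (\<phi> x))\<^sup>2) summable_on X"
    by (intro summable_on_cmult_right ell2_summable assms)
  then show "dyad X \<phi> \<psi> f \<in> ell2 X"
    unfolding eq[symmetric] using assms(1) by (simp add: ell2_def dyad_def)
  have "(cmod (cinner X \<psi> f))\<^sup>2 \<le> (sqrt (energy X \<psi>) * sqrt (energy X f))\<^sup>2"
    by (rule power_mono[OF cmod_cinner_le[OF assms(2) f]]) simp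
  also have "\<dots> = energy X \<psi> * energy X f"
    by (simp add: power_mult_distrib energy_nonneg)
  finally have c: "(cmod (cinner X \<psi> f))\<^sup>2 \<le> energy X \<psi> * energy X f" .
  have "energy X (dyad X \<phi> \<psi> f) = (cmod (cinner X \<psi> f))\<^sup>2 * energy X \<phi>"
    unfolding eq by (rule infsum_cmult_right')
  also have "\<dots> \<le> (energy X \<psi> * energy X f) * energy X \<phi>"
    by (rule mult_right_mono[OF c energy_nonneg])
  finally show "energy X (dyad X \<phi> \<psi> f) \<le> energy X \<phi> * energy X \<psi> * energy X f"
    by (simp add: mult_ac)
qed (simp add: energy_nonneg)

section \<open>Slices and extensions\<close>

text \<open>The argument that \<open>ext\<close> hands to the inner operator: outside
  \<open>W\<close> the labels are frozen at those of \<open>s\<close>.\<close>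

definition slice :: "('q \<Rightarrow> 'b set) \<Rightarrow> ('q \<Rightarrow> 'b) \<Rightarrow> 'q set \<Rightarrow> ('q \<Rightarrow> 'b)
    \<Rightarrow> ('q \<Rightarrow> 'b) amp \<Rightarrow> ('q \<Rightarrow> 'b) amp" where
  "slice B r W s f = (\<lambda>t. if t \<in> labels B r W then f (override_on s t W) else 0)"

lemma ext_slice:
  "ext B r V W A f s = (if f \<in> ell2 (labels B r V) \<and> s \<in> labels B r V
     then A (slice B r W s f) (restrict s W) else 0)"
  by (simp add: ext_def slice_def)

section \<open>Restricting and gluing labels\<close>

lemma labels_restrict: "s \<in> labels B r V \<Longrightarrow> W \<subseteq> V \<Longrightarrow> restrict s W \<in> labels B r W"
  by (auto simp: labels_def PiE_iff extensional_def elim!: rev_finite_subset)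

text \<open>The override deviates from \<open>r\<close> in finitely many variables because both
  \<open>s\<close> and \<open>t\<close> do.\<close>

lemma labels_override:
  assumes "s \<in> labels B r V" "t \<in> labels B r W" "W \<subseteq> V"
  shows "override_on s t W \<in> labels B r V"
proof -
  have "{q \<in> V. override_on s t W q \<noteq> r q} \<subseteq> {q \<in> V. s q \<noteq> r q} \<union> {q \<in> W. t q \<noteq> r q}"
    by (auto simp: override_on_def)
  moreover have "finite ({q \<in> V. s q \<noteq> r q} \<union> {q \<in> W. t q \<noteq> r q})"
    using assms by (simp add: labels_def)
  ultimately have "finite {q \<in> V. override_on s t W q \<noteq> r q}"
    by (rule finite_subset)
  then show ?thesis
    using assms by (auto simp: labels_def PiE_iff extensional_def override_on_def)
qed

text \<open>Here \<open>s\<close> is given only outside \<open>W\<close>. Together with restriction,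
  this matches labels of \<open>V\<close> with pairs of labels of \<open>V - W\<close> and of
  \<open>W\<close>.\<close>

lemma labels_override_disjoint:
  assumes "s \<in> labels B r (V - W)" "t \<in> labels B r W" "W \<subseteq> V"
  shows "override_on s t W \<in> labels B r V"
proof -
  have "{q \<in> V. override_on s t W q \<noteq> r q} \<subseteq> {q \<in> V - W. s q \<noteq> r q} \<union> {q \<in> W. t q \<noteq> r q}"
    by (auto simp: override_on_def)
  moreover have "finite ({q \<in> V - W. s q \<noteq> r q} \<union> {q \<in> W. t q \<noteq> r q})"
    using assms by (simp add: labels_def)
  ultimately have "finite {q \<in> V. override_on s t W q \<noteq> r q}"
    by (rule finite_subset)
  then show ?thesis
    using assms by (auto simp: labels_def PiE_iff extensional_def override_on_def)
qed

lemma labels_eqI: "s \<in> labels B r V \<Longrightarrow> t \<in> labels B r V \<Longrightarrow> (\<And>q. q \<in> V \<Longrightarrow> s q = t q) \<Longrightarrow> s = t"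
  by (auto simp: labels_def intro: PiE_ext)

lemma inj_on_override: "inj_on (\<lambda>t. override_on s t W) (labels B r W)"
  by (rule inj_onI, erule (1) labels_eqI) (metis override_on_apply_in)

lemma slice_ell2:
  assumes "f \<in> ell2 (labels B r V)" "s \<in> labels B r V" "W \<subseteq> V"
  shows "slice B r W s f \<in> ell2 (labels B r W)"
  unfolding slice_def
  by (rule ell2_reindex(1)[OF inj_on_override _ assms(1)]) (use labels_override assms in fast)

text \<open>The nested override takes its values from \<open>t\<close> on \<open>W\<close> and from
  \<open>s\<close> everywhere else: directly outside \<open>U\<close>, through the restriction on
  \<open>U - W\<close>.\<close>

lemma slice_slice:
  assumes "s \<in> labels B r V" "W \<subseteq> U" "U \<subseteq> V"
  shows "slice B r W (restrict s U) (slice B r U s f) = slice B r W s f"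
proof
  fix t
  have "override_on s (override_on (restrict s U) t W) U = override_on s t W"
    using assms(2) by (auto simp: override_on_def fun_eq_iff)
  then show "slice B r W (restrict s U) (slice B r U s f) t = slice B r W s f t"
    using labels_override[OF labels_restrict[OF assms(1,3)] _ assms(2)]
    by (simp add: slice_def)
qed

text \<open>Both sides apply \<open>A\<close> to the same slice over \<open>W\<close>. The guard in
  the inner \<open>ext\<close> holds because slices of square-summable functions are
  square-summable.\<close>

lemma ext_ext:
  assumes "W \<subseteq> U" "U \<subseteq> V"
  shows "ext B r V U (ext B r U W A) = ext B r V W A"
proof (intro HOL.ext)
  fix f s
  show "ext B r V U (ext B r U W A) f s = ext B r V W A f s"
  proof (cases "f \<in> ell2 (labels B r V) \<and> s \<in> labels B r V")
    case True
    then show ?thesis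
      using assms slice_ell2[of f B r V s U] labels_restrict[of s B r V U]
      by (simp add: ext_slice slice_slice[of s B r V W U] Int_absorb1)
  qed (auto simp: ext_slice)
qed

text \<open>All labels in one slice over \<open>U\<close> agree outside \<open>U\<close>, so the
  extended operator reads a single slice of \<open>f\<close> there.\<close>

lemma slice_ext:
  assumes "f \<in> ell2 (labels B r V)" "s \<in> labels B r V" "U \<subseteq> V" "ell2_bounded (labels B r U) A"
  shows "slice B r U s (ext B r V U A f) = A (slice B r U s f)"
proof
  fix t
  show "slice B r U s (ext B r V U A f) t = A (slice B r U s f) t"
  proof (cases "t \<in> labels B r U")
    case True
    have "restrict (override_on s t U) U = t"
      using True by (auto simp: fun_eq_iff labels_def PiE_iff extensional_def)
    \<comment> \<open>A second override on \<open>U\<close> forgets the first.\<close>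
    moreover have "slice B r U (override_on s t U) f = slice B r U s f"
      unfolding slice_def
      by (rule HOL.ext, rule if_cong[OF refl _ refl], rule arg_cong[of _ _ f])
        (auto simp: override_on_def fun_eq_iff)
    ultimately show ?thesis
      using True assms labels_override[OF assms(2) True assms(3)]
      by (simp add: ext_slice slice_def[of B r U s "ext B r V U A f"])
  next
    case False
    \<comment> \<open>The right-hand side vanishes too, since a bounded \<open>A\<close> maps into
      \<open>ell2\<close>.\<close>
    then show ?thesis
      using ell2_outside[OF ell2_bounded_in[OF assms(4) slice_ell2[OF assms(1,2,3)]] False]
      by (simp add: slice_def)
  qed
qed

text \<open>\<open>A\<close> acts on each slice separately with the same constant \<open>K\<close>,
  so the bound survives summation over all slices (Tonelli). Labels of \<open>V\<close> and pairs of
  labels are compared by injections in both directions, each giving one inequality.\<close>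

lemma ell2_bounded_ext:
  assumes "U \<subseteq> V" "ell2_bounded (labels B r U) A"
  shows "ell2_bounded (labels B r V) (ext B r V U A)"
proof -
  obtain K where K: "K \<ge> 0" "\<And>f. f \<in> ell2 (labels B r U) \<Longrightarrow>
      A f \<in> ell2 (labels B r U) \<and> energy (labels B r U) (A f) \<le> K * energy (labels B r U) f"
    using assms(2) unfolding ell2_bounded_def by blast
  let ?V = "labels B r V" and ?U = "labels B r U" and ?D = "labels B r (V - U)"
  have *: "ext B r V U A f \<in> ell2 ?V \<and> energy ?V (ext B r V U A f) \<le> K * energy ?V f"
    if f: "f \<in> ell2 ?V" for f
  proof -
    \<comment> \<open>\<open>F\<close> and \<open>H\<close> are the squared moduli of
      \<open>f\<close> and of its image, in the coordinates \<open>u\<close> outside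
      \<open>U\<close> and \<open>t\<close> on \<open>U\<close>.\<close>
    define F where "F = (\<lambda>(u, t). (cmod (f (override_on u t U)))\<^sup>2)"
    define H where "H = (\<lambda>(u, t). (cmod (A (slice B r U u f) t))\<^sup>2)"
    have inj: "inj_on (\<lambda>(u, t). override_on u t U) (?D \<times> ?U)"
    proof (rule inj_onI, clarify)
      fix u t u' t' assume h: "u \<in> ?D" "t \<in> ?U" "u' \<in> ?D" "t' \<in> ?U"
        "override_on u t U = override_on u' t' U"
      have "u = u'"
        by (rule labels_eqI[OF h(1,3)]) (use h(5) in \<open>metis DiffD2 override_on_apply_notin\<close>)
      moreover have "t = t'"
        by (rule labels_eqI[OF h(2,4)]) (use h(5) in \<open>metis override_on_apply_in\<close>)
      ultimately show "u = u' \<and> t = t'" by simp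
    qed
    have img: "(\<lambda>(u, t). override_on u t U) ` (?D \<times> ?U) \<subseteq> ?V"
      using labels_override_disjoint[OF _ _ assms(1)] by fast
    have F: "F summable_on ?D \<times> ?U" "infsum F (?D \<times> ?U) \<le> energy ?V f"
      using nonneg_reindex[OF inj img ell2_summable[OF f]]
      by (simp_all add: F_def case_prod_unfold)
    \<comment> \<open>The label \<open>u\<close> lives only on \<open>V - U\<close>, so
      \<open>slice_ell2\<close> does not apply and the pullback argument is repeated.\<close>
    have sl: "slice B r U u f \<in> ell2 ?U" if "u \<in> ?D" for u
      unfolding slice_def
      by (rule ell2_reindex(1)[OF inj_on_override _ f])
        (use labels_override_disjoint[OF that _ assms(1)] in fast)
    have eF: "energy ?U (slice B r U u f) = (\<Sum>\<^sub>\<infinity>t\<in>?U. F (u, t))" for u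
      by (rule infsum_cong) (simp add: F_def slice_def)
    define E where "E u = energy ?U (A (slice B r U u f))" for u
    have E: "E u \<le> K * (\<Sum>\<^sub>\<infinity>t\<in>?U. F (u, t))" if "u \<in> ?D" for u
      using K(2)[OF sl[OF that]] unfolding E_def eF by blast
    have E0: "E u \<ge> 0" for u
      unfolding E_def by (rule energy_nonneg)
    have sF: "(\<lambda>u. K * (\<Sum>\<^sub>\<infinity>t\<in>?U. F (u, t))) summable_on ?D"
      using summable_on_Sigma_banach[of "\<lambda>u t. F (u, t)" ?D "\<lambda>_. ?U"] F(1)
      by (intro summable_on_cmult_right) simp
    have sE: "E summable_on ?D"
      by (rule summable_on_comparison_test[OF sF]) (use E E0 in auto)
    \<comment> \<open>For nonnegative terms, summable inner sums \<open>E\<close> suffice for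
      summability over the product.\<close>
    have H: "H summable_on ?D \<times> ?U"
    proof (rule summable_on_SigmaI[OF _ sE])
      show "((\<lambda>t. H (u, t)) has_sum E u) ?U" if "u \<in> ?D" for u
        unfolding E_def H_def using K(2)[OF sl[OF that]]
        by (simp add: ell2_summable has_sum_infsum)
    qed (simp add: H_def)
    have "infsum H (?D \<times> ?U) = infsum E ?D"
      using infsum_Sigma_banach[OF H] by (simp add: E_def[abs_def] H_def)
    also have "\<dots> \<le> (\<Sum>\<^sub>\<infinity>u\<in>?D. K * (\<Sum>\<^sub>\<infinity>t\<in>?U. F (u, t)))"
      by (rule infsum_mono[OF sE sF E])
    also have "\<dots> = K * infsum F (?D \<times> ?U)"
      by (simp add: infsum_cmult_right' infsum_Sigma_banach[OF F(1)])
    also have "\<dots> \<le> K * energy ?V f"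
      by (rule mult_left_mono[OF F(2) K(1)])
    finally have le: "infsum H (?D \<times> ?U) \<le> K * energy ?V f" .
    \<comment> \<open>The way back: a label of \<open>V\<close> is determined by its two
      restrictions, so the energy of the image is at most the sum of \<open>H\<close>.\<close>
    have inj': "inj_on (\<lambda>s. (restrict s (V - U), restrict s U)) ?V"
    proof (rule inj_onI)
      fix s s' assume s: "s \<in> ?V" "s' \<in> ?V"
        and "(restrict s (V - U), restrict s U) = (restrict s' (V - U), restrict s' U)"
      then have "restrict s (V - U) q = restrict s' (V - U) q" "restrict s U q = restrict s' U q" for q
        by auto
      then have "s q = s' q" if "q \<in> V" for q
        using that by (cases "q \<in> U") (metis restrict_apply', metis DiffI restrict_apply')
      then show "s = s'"
        by (rule labels_eqI[OF s])
    qed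
    have img': "(\<lambda>s. (restrict s (V - U), restrict s U)) ` ?V \<subseteq> ?D \<times> ?U"
      using labels_restrict[OF _ assms(1)] labels_restrict[of _ B r V "V - U"] by auto
    have eq: "(cmod (ext B r V U A f s))\<^sup>2 = H (restrict s (V - U), restrict s U)"
      if s: "s \<in> ?V" for s
    proof -
      have o: "override_on (restrict s (V - U)) t U = override_on s t U" if "t \<in> ?U" for t
        using s assms(1)
        by (auto simp: override_on_def fun_eq_iff labels_def PiE_iff extensional_def)
      have "slice B r U (restrict s (V - U)) f = slice B r U s f"
        unfolding slice_def
        by (rule HOL.ext, rule if_cong[OF refl _ refl], rule arg_cong[of _ _ f], rule o)
      then show ?thesis
        using f s by (simp add: ext_slice H_def)
    qed
    note r = nonneg_reindex[OF inj' img' H]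
    have H0: "H p \<ge> 0" for p
      by (simp add: H_def split: prod.split)
    have "(\<lambda>s. (cmod (ext B r V U A f s))\<^sup>2) summable_on ?V \<longleftrightarrow>
        (\<lambda>s. H (restrict s (V - U), restrict s U)) summable_on ?V"
      by (rule summable_on_cong[OF eq])
    then have "(\<lambda>s. (cmod (ext B r V U A f s))\<^sup>2) summable_on ?V"
      using r(1)[OF H0] by simp
    moreover have "energy ?V (ext B r V U A f) = (\<Sum>\<^sub>\<infinity>s\<in>?V. H (restrict s (V - U), restrict s U))"
      by (rule infsum_cong[OF eq])
    then have "energy ?V (ext B r V U A f) \<le> K * energy ?V f"
      using r(2)[OF H0] le by linarith
    ultimately show ?thesis
      by (simp add: ell2_def ext_slice)
  qed
  show ?thesis
    by (rule ell2_boundedI[OF K(1)]) (use * in auto)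
qed

text \<open>By \<open>slice_ext\<close> the outer extension sees \<open>A'\<close> applied to the
  slice of \<open>f\<close>; the intermediate vector passes the guard of \<open>ext\<close> by
  \<open>ell2_bounded_ext\<close>.\<close>

lemma ext_comp:
  assumes "f \<in> ell2 (labels B r V)" "U \<subseteq> V" "ell2_bounded (labels B r U) A'"
  shows "ext B r V U (A \<circ> A') f = ext B r V U A (ext B r V U A' f)"
  using assms ell2_bounded_in[OF ell2_bounded_ext[OF assms(2,3)] assms(1)]
  by (auto simp: ext_slice[of B r V U A] ext_slice[of B r V U "A \<circ> A'"] slice_ext)

text \<open>Both sides are 0 off \<open>ell2\<close>. Equality as functions permits rewriting under
  a further \<open>ext\<close>.\<close>

lemma ext_cong:
  assumes "op_eq (labels B r V) (ext B r V U A) (ext B r V W A')"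
  shows "ext B r V U A = ext B r V W A'"
proof (intro HOL.ext)
  fix f s
  show "ext B r V U A f s = ext B r V W A' f s"
    using assms by (cases "f \<in> ell2 (labels B r V)") (auto simp: op_eq_def ext_slice)
qed

section \<open>Circuits\<close>

lemma in_listset: "bs \<in> listset As \<longleftrightarrow> length bs = length As \<and> (\<forall>i<length As. bs ! i \<in> As ! i)"
proof (induction As arbitrary: bs)
  case (Cons A As)
  then show ?case
    by (cases bs) (auto simp: set_Cons_def less_Suc_eq_0_disj)
qed simp

text \<open>\<open>place\<close> is \<open>A\<close> between two pullbacks, from label functions to
  label lists and back; neither increases the energy.\<close>

lemma ell2_bounded_place:
  fixes B :: "'q \<Rightarrow> 'b set"
  assumes "distinct q" "ell2_bounded (reg_labels B q) A"
  shows "ell2_bounded (labels B r (set q)) (place B r q A)"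
proof -
  let ?L = "labels B r (set q)" and ?R = "reg_labels B q"
  define h :: "'b list \<Rightarrow> 'q \<Rightarrow> 'b" where "h = (\<lambda>bs. \<lambda>v\<in>set q. the (map_of (zip q bs) v))"
  obtain K where K: "K \<ge> 0" "\<And>f. f \<in> ell2 ?R \<Longrightarrow>
      A f \<in> ell2 ?R \<and> energy ?R (A f) \<le> K * energy ?R f"
    using assms(2) unfolding ell2_bounded_def by blast
  \<comment> \<open>Distinctness of \<open>q\<close> makes the lookup by variable agree with the
    lookup by position.\<close>
  have h: "h bs (q ! i) = bs ! i" if "bs \<in> ?R" "i < length q" for bs i
    using that assms(1) by (simp add: h_def reg_labels_def in_listset map_of_zip_nth)
  have hL: "h ` ?R \<subseteq> ?L"
  proof clarify
    fix bs assume bs: "bs \<in> ?R"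
    have "h bs v \<in> B v" if "v \<in> set q" for v
      using that h[OF bs] bs by (auto simp: in_set_conv_nth reg_labels_def in_listset)
    \<comment> \<open>Deviation from \<open>r\<close> is finite automatically, since
      \<open>set q\<close> is finite.\<close>
    then show "h bs \<in> ?L"
      by (auto simp: labels_def PiE_iff h_def)
  qed
  have hinj: "inj_on h ?R"
  proof (rule inj_onI)
    fix x y assume xy: "x \<in> ?R" "y \<in> ?R" "h x = h y"
    show "x = y"
    proof (rule nth_equalityI)
      show "length x = length y"
        using xy by (simp add: reg_labels_def in_listset)
      show "x ! i = y ! i" if "i < length x" for i
        using that h[of x i] h[of y i] xy by (simp add: reg_labels_def in_listset)
    qed
  qed
  have mR: "(\<lambda>s. map s q) ` ?L \<subseteq> ?R"
    by (auto simp: labels_def reg_labels_def in_listset PiE_iff)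
  have minj: "inj_on (\<lambda>s. map s q) ?L"
    by (rule inj_onI, erule (1) labels_eqI) auto
  show ?thesis
  proof (rule ell2_boundedI[OF K(1)])
    fix f assume f: "f \<in> ell2 ?L"
    let ?g = "\<lambda>bs. if bs \<in> ?R then f (h bs) else 0"
    have g: "?g \<in> ell2 ?R" "energy ?R ?g \<le> energy ?L f"
      using ell2_reindex[OF hinj hL f] by blast+
    have pl: "place B r q A f = (\<lambda>s. if s \<in> ?L then A ?g (map s q) else 0)"
      unfolding place_def h_def by (rule refl)
    show "place B r q A f \<in> ell2 ?L"
      unfolding pl using ell2_reindex(1)[OF minj mR] K(2)[OF g(1)] by blast
    have "energy ?L (place B r q A f) \<le> energy ?R (A ?g)"
      unfolding pl using ell2_reindex(2)[OF minj mR] K(2)[OF g(1)] by blast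
    also have "\<dots> \<le> K * energy ?R ?g"
      using K(2)[OF g(1)] by blast
    also have "\<dots> \<le> K * energy ?L f"
      by (rule mult_left_mono[OF g(2) K(1)])
    finally show "energy ?L (place B r q A f) \<le> K * energy ?L f" .
  qed
qed

lemma ell2_bounded_place_dyad:
  assumes "distinct q" "orthonormal_basis (reg_labels B q) d \<psi>" "i \<in> {1..d}"
  shows "ell2_bounded (labels B r (set q)) (place B r q (dyad (reg_labels B q) (\<psi> i) (\<psi> i)))"
  using assms by (intro ell2_bounded_place ell2_bounded_dyad) (auto simp: orthonormal_basis_def)

text \<open>Gates are bounded because they are unitary. Boundedness, unlike unitarity, also holds
  for the single summands of a \<open>QIf\<close>, so it passes through the induction.\<close>

lemma ell2_bounded_csem:
  "wf_circuit B G C \<Longrightarrow> ell2_bounded (labels B r (qv C)) (csem B r C)"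
proof (induction C)
  case CSkip
  show ?case
    unfolding csem.simps by (rule ell2_bounded_id)
next
  case (Gate U q)
  then show ?case
    by (simp add: ell2_bounded_place bounded_op_ell2_bounded unitary_def)
next
  case (CSeq C\<^sub>1 C\<^sub>2)
  then show ?case
    unfolding csem.simps qv.simps by (intro ell2_bounded_comp ell2_bounded_ext) auto
next
  case (QIf q d \<psi> C)
  then show ?case
    unfolding csem.simps qv.simps Let_def
    by (intro ell2_bounded_sum ell2_bounded_comp ell2_bounded_ext ell2_bounded_place_dyad) auto
qed

text \<open>\<open>ext_comp\<close> separates the two factors, and \<open>ext_ext\<close> merges
  their nested extensions, which removes the union of the variable sets.\<close>

lemma ext_CSeq:
  assumes "wf_circuit B G (CSeq C\<^sub>1 C\<^sub>2)" "qv (CSeq C\<^sub>1 C\<^sub>2) \<subseteq> V" "f \<in> ell2 (labels B r V)"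
  shows "ext B r V (qv (CSeq C\<^sub>1 C\<^sub>2)) (csem B r (CSeq C\<^sub>1 C\<^sub>2)) f =
    ext B r V (qv C\<^sub>2) (csem B r C\<^sub>2) (ext B r V (qv C\<^sub>1) (csem B r C\<^sub>1) f)"
proof -
  have sub: "qv C\<^sub>1 \<subseteq> qv C\<^sub>1 \<union> qv C\<^sub>2" "qv C\<^sub>2 \<subseteq> qv C\<^sub>1 \<union> qv C\<^sub>2"
    by auto
  note V = assms(2)[unfolded qv.simps]
  have "ell2_bounded (labels B r (qv C\<^sub>1)) (csem B r C\<^sub>1)"
    using assms(1) by (auto intro: ell2_bounded_csem)
  from ext_comp[OF assms(3) V ell2_bounded_ext[OF sub(1) this],
      of "ext B r (qv C\<^sub>1 \<union> qv C\<^sub>2) (qv C\<^sub>2) (csem B r C\<^sub>2)"]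
  show ?thesis
    unfolding csem.simps qv.simps unfolding ext_ext[OF sub(1) V] ext_ext[OF sub(2) V] .
qed

text \<open>Branch by branch this is the argument for sequencing, with the projector as the second
  factor.\<close>

lemma ext_QIf:
  assumes "wf_circuit B G (QIf q d \<psi> C)" "qv (QIf q d \<psi> C) \<subseteq> V" "f \<in> ell2 (labels B r V)"
  shows "ext B r V (qv (QIf q d \<psi> C)) (csem B r (QIf q d \<psi> C)) f =
    (\<lambda>s. \<Sum>i=1..d. reg_ext B r V q (dyad (reg_labels B q) (\<psi> i) (\<psi> i))
      (ext B r V (qv (C i)) (csem B r (C i)) f) s)"
proof
  fix s
  let ?U = "qv (QIf q d \<psi> C)"
  let ?D = "\<lambda>W i. reg_ext B r W q (dyad (reg_labels B q) (\<psi> i) (\<psi> i))"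
  let ?E = "\<lambda>W i. ext B r W (qv (C i)) (csem B r (C i))"
  \<comment> \<open>At a fixed \<open>s\<close>, \<open>ext\<close> evaluates the operator at one
    coordinate of one slice, so it distributes over the pointwise sum.\<close>
  have "ext B r V ?U (csem B r (QIf q d \<psi> C)) f s =
      (\<Sum>i=1..d. ext B r V ?U (?D ?U i \<circ> ?E ?U i) f s)"
    by (cases "s \<in> labels B r V") (simp_all add: ext_slice[of B r V] Let_def assms(3))
  also have "\<dots> = (\<Sum>i=1..d. ?D V i (?E V i f) s)"
  proof (rule sum.cong[OF refl])
    fix i assume i: "i \<in> {1..d}"
    have sub: "set q \<subseteq> ?U" "qv (C i) \<subseteq> ?U"
      using i by auto
    have "ell2_bounded (labels B r (qv (C i))) (csem B r (C i))"
      using assms(1) i by (auto intro: ell2_bounded_csem)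
    then have "ext B r V ?U (?D ?U i \<circ> ?E ?U i) f =
        ext B r V ?U (?D ?U i) (ext B r V ?U (?E ?U i) f)"
      by (intro ext_comp[OF assms(3,2)] ell2_bounded_ext[OF sub(2)])
    then show "ext B r V ?U (?D ?U i \<circ> ?E ?U i) f s = ?D V i (?E V i f) s"
      unfolding ext_ext[OF sub(1) assms(2)] ext_ext[OF sub(2) assms(2)] by simp
  qed
  finally show "ext B r V ?U (csem B r (QIf q d \<psi> C)) f s = (\<Sum>i=1..d. ?D V i (?E V i f) s)" .
qed

text \<open>Equivalence compares the circuits on the union of their variables;
  \<open>ext_ext\<close> carries this to any larger set.\<close>

lemma circ_equiv_ext:
  assumes "circ_equiv B r C D" "qv C \<union> qv D \<subseteq> V"
  shows "ext B r V (qv C) (csem B r C) = ext B r V (qv D) (csem B r D)"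
proof -
  let ?U = "qv C \<union> qv D"
  have "ext B r ?U (qv C) (csem B r C) = ext B r ?U (qv D) (csem B r D)"
    using assms(1) unfolding circ_equiv_def by (rule ext_cong)
  then have "ext B r V ?U (ext B r ?U (qv C) (csem B r C)) =
      ext B r V ?U (ext B r ?U (qv D) (csem B r D))"
    by simp
  then show ?thesis
    using assms(2) by (simp add: ext_ext)
qed

text \<open>On all variables the induction hypotheses live on one common space even where the
  \<open>qv\<close> of partners differ. Well-formedness of both sides supplies the boundedness
  behind \<open>ext_CSeq\<close> and \<open>ext_QIf\<close>.\<close>

lemma csubst_ext:
  assumes "csubst R C D" "wf_circuit B G C" "wf_circuit B G D"
    and "\<And>C D. (C, D) \<in> R \<Longrightarrow> circ_equiv B r C D"
  shows "ext B r UNIV (qv C) (csem B r C) = ext B r UNIV (qv D) (csem B r D)"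
  using assms(1-3)
proof (induction rule: csubst.induct)
  case (replace C D)
  then show ?case by (simp add: assms(4) circ_equiv_ext)
next
  case (keep C)
  show ?case by simp
next
  case (seq C\<^sub>1 D\<^sub>1 C\<^sub>2 D\<^sub>2)
  \<comment> \<open>The decompositions are available for vectors in \<open>ell2\<close> only;
    \<open>ext_cong\<close> covers the other arguments.\<close>
  have "op_eq (labels B r UNIV)
      (ext B r UNIV (qv (CSeq C\<^sub>1 C\<^sub>2)) (csem B r (CSeq C\<^sub>1 C\<^sub>2)))
      (ext B r UNIV (qv (CSeq D\<^sub>1 D\<^sub>2)) (csem B r (CSeq D\<^sub>1 D\<^sub>2)))"
    unfolding op_eq_def
  proof
    fix f assume f: "f \<in> ell2 (labels B r UNIV)"
    show "ext B r UNIV (qv (CSeq C\<^sub>1 C\<^sub>2)) (csem B r (CSeq C\<^sub>1 C\<^sub>2)) f =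
        ext B r UNIV (qv (CSeq D\<^sub>1 D\<^sub>2)) (csem B r (CSeq D\<^sub>1 D\<^sub>2)) f"
      unfolding ext_CSeq[OF seq.prems(1) subset_UNIV f] ext_CSeq[OF seq.prems(2) subset_UNIV f]
      using seq by simp
  qed
  then show ?case by (rule ext_cong)
next
  case (qif d C D q \<psi>)
  have "op_eq (labels B r UNIV)
      (ext B r UNIV (qv (QIf q d \<psi> C)) (csem B r (QIf q d \<psi> C)))
      (ext B r UNIV (qv (QIf q d \<psi> D)) (csem B r (QIf q d \<psi> D)))"
    unfolding op_eq_def
  proof
    fix f assume f: "f \<in> ell2 (labels B r UNIV)"
    show "ext B r UNIV (qv (QIf q d \<psi> C)) (csem B r (QIf q d \<psi> C)) f =
        ext B r UNIV (qv (QIf q d \<psi> D)) (csem B r (QIf q d \<psi> D)) f"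
      unfolding ext_QIf[OF qif.prems(1) subset_UNIV f] ext_QIf[OF qif.prems(2) subset_UNIV f]
      \<comment> \<open>The projectors coincide literally, being extended to \<open>UNIV\<close>
        rather than to the variables of either circuit.\<close>
      using qif by (intro HOL.ext sum.cong) auto
  qed
  then show ?case by (rule ext_cong)
qed

section \<open>Programs\<close>

text \<open>Program semantics sees a circuit only through its extension to \<open>UNIV\<close>.
  Equality on all arguments passes directly through compositions and loop iterates, without an
  invariant saying that intermediate operators are partial density operators.\<close>

lemma psubst_psem:
  assumes "psubst R P Q" "wf_prog B G P" "wf_prog B G Q"
    and "\<And>C D. (C, D) \<in> R \<Longrightarrow> circ_equiv B r C D"
  shows "psem B r P = psem B r Q"
  using assms(1-3)
proof (induction rule: psubst.induct)
  case (circ C D)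
  then have "ext B r UNIV (qv C) (csem B r C) = ext B r UNIV (qv D) (csem B r D)"
    using csubst_ext[OF circ(1)] assms(4) by simp
  then show ?case by simp
next
  case (cond Out P Q M q)
  \<comment> \<open>The branches are related only for outcomes in \<open>Out\<close>, which is
    exactly the index set of the sum.\<close>
  then show ?case
    by (auto simp: op_sum_def fun_eq_iff intro!: infsum_cong)
qed auto

theorem lemma5p1:
  fixes B :: "'q \<Rightarrow> 'b set" and r :: "'q \<Rightarrow> 'b"
    and G :: "'b list op set"
    and P Q :: "('q, 'b, 'm) prog"
    and n :: nat and C D :: "nat \<Rightarrow> ('q, 'b) circuit"
  assumes "\<And>q. r q \<in> B q"
    and "wf_prog B G P" and "wf_prog B G Q"
    and "\<And>i. i \<in> {1..n} \<Longrightarrow> wf_circuit B G (C i)"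
    and "\<And>i. i \<in> {1..n} \<Longrightarrow> wf_circuit B G (D i)"
    and "psubst {(C i, D i) | i. i \<in> {1..n}} P Q"
    and "\<And>i. i \<in> {1..n} \<Longrightarrow> circ_equiv B r (C i) (D i)"
  shows "prog_equiv B r P Q"
proof -
  have "psem B r P = psem B r Q"
    by (rule psubst_psem[OF assms(6,2,3)]) (use assms(7) in blast)
  then show ?thesis
    by (simp add: prog_equiv_def op_eq_def)
qed

end
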